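(* There exist linearly independent vectors $\vec u,\vec v,\vec w\in\mathbb{R}^3$ spanning a parallelepiped whose three edge lengths are $271$, $106$, $103$, whose three minor face diagonal lengths are $101$, $266$, $255$, whose three major face diagonal lengths are $183$, $312$, $323$, and whose four body diagonal lengths are $374$, $300$, $278$, $272$. In particular, a perfect parallelepiped exists.
   Context: A parallelepiped in $\mathbb{R}^3$ is spanned by three linearly independent edge vectors $\vec u,\vec v,\vec w$. Its edge lengths are $\|\vec u\|,\|\vec v\|,\|\vec w\|$. Each of its three faces is a parallelogram spanned by a pair of edge vectors $\vec a,\vec b$; that face has two diagonals, of lengths $\|\vec a-\vec b\|$ and $\|\vec a+\vec b\|$. The shorter one is the minor diagonal and the longer one is the major diagonal; they coincide when the face is a rectangle. The four body diagonal lengths are $\|\vec u+\vec v+\vec w\|$, $\|\vec u+\vec v-\vec w\|$, $\|\vec u-\vec v+\vec w\|$ and $\|-\vec u+\vec v+\vec w\|$. A parallelepiped is perfect if all its edge lengths, face diagonal lengths and body diagonal lengths are positive integers. *)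

theory Defs
  imports "HOL-Analysis.Analysis"
begin

text \<open>
  A parallelepiped is given by its edge vectors. Distinctness is required explicitly because
  independence of a set does not see repeated vectors.
\<close>

definition spans_parallelepiped :: "real ^ 3 \<Rightarrow> real ^ 3 \<Rightarrow> real ^ 3 \<Rightarrow> bool" where
  "spans_parallelepiped u v w \<longleftrightarrow> distinct [u, v, w] \<and> independent {u, v, w}"

definition minor_diagonal :: "real ^ 3 \<Rightarrow> real ^ 3 \<Rightarrow> real" where
  "minor_diagonal a b = min (norm (a - b)) (norm (a + b))"

definition major_diagonal :: "real ^ 3 \<Rightarrow> real ^ 3 \<Rightarrow> real" where
  "major_diagonal a b = max (norm (a - b)) (norm (a + b))"

definition edge_lengths :: "real ^ 3 \<Rightarrow> real ^ 3 \<Rightarrow> real ^ 3 \<Rightarrow> real list" where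
  "edge_lengths u v w = [norm u, norm v, norm w]"

text \<open>
  The faces are listed so that the \<open>i\<close>-th face is the one not containing the \<open>i\<close>-th edge vector.
\<close>

definition minor_face_diagonal_lengths :: "real ^ 3 \<Rightarrow> real ^ 3 \<Rightarrow> real ^ 3 \<Rightarrow> real list" where
  "minor_face_diagonal_lengths u v w =
    [minor_diagonal v w, minor_diagonal u w, minor_diagonal u v]"

definition major_face_diagonal_lengths :: "real ^ 3 \<Rightarrow> real ^ 3 \<Rightarrow> real ^ 3 \<Rightarrow> real list" where
  "major_face_diagonal_lengths u v w =
    [major_diagonal v w, major_diagonal u w, major_diagonal u v]"

definition body_diagonal_lengths :: "real ^ 3 \<Rightarrow> real ^ 3 \<Rightarrow> real ^ 3 \<Rightarrow> real list" where
  "body_diagonal_lengths u v w =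
    [norm (u + v + w), norm (u + v - w), norm (u - v + w), norm (- u + v + w)]"

definition perfect_parallelepiped :: "real ^ 3 \<Rightarrow> real ^ 3 \<Rightarrow> real ^ 3 \<Rightarrow> bool" where
  "perfect_parallelepiped u v w \<longleftrightarrow>
    spans_parallelepiped u v w \<and>
    (\<forall>l \<in> set (edge_lengths u v w) \<union> set (minor_face_diagonal_lengths u v w) \<union>
          set (major_face_diagonal_lengths u v w) \<union> set (body_diagonal_lengths u v w).
       \<exists>n::nat. 0 < n \<and> l = real n)"

end

theory Submission
  imports Defs
begin

text \<open>
  By polarization, the edge and face diagonal lengths prescribe the Gram matrix of \<open>u, v, w\<close>:
  for each face the inner product of its edges is a quarter of the difference of the squared
  diagonals. This matrix is positive definite, so a Cholesky factorization realizes it by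
  independent vectors, and the body diagonals then turn out to have the required lengths.
\<close>

text \<open>Each vector has a nonzero entry in a coordinate where all earlier ones vanish, so it
  lies outside their span.\<close>

lemma spans_parallelepiped_triangular:
  assumes "a \<noteq> 0" "c \<noteq> 0" "f \<noteq> 0"
  shows "spans_parallelepiped (vector [a, 0, 0]) (vector [b, c, 0]) (vector [d, e, f])"
proof -
  let ?u = "vector [a, 0, 0] :: real ^ 3" and ?v = "vector [b, c, 0] :: real ^ 3"
    and ?w = "vector [d, e, f] :: real ^ 3"
  have u: "?u \<noteq> 0"
    using assms by (auto simp: vec_eq_iff forall_3)
  have v: "?v \<notin> span {?u}"
    using assms by (auto simp: span_singleton vec_eq_iff forall_3)
  have w: "?w \<notin> span {?v, ?u}"
    using assms by (auto simp: span_insert span_singleton vec_eq_iff forall_3)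
  have "distinct [?u, ?v, ?w]"
    using assms by (auto simp: vec_eq_iff forall_3)
  moreover have "independent {?w, ?v, ?u}"
    using u v w by (simp add: independent_insert)
  ultimately show ?thesis
    by (simp add: spans_parallelepiped_def insert_commute)
qed

text \<open>The three hypotheses are Sylvester's criterion: positive leading principal minors of the
  symmetric matrix with rows \<open>(a, h, g)\<close>, \<open>(h, b, f)\<close>,
  \<open>(g, f, c)\<close>. The vectors are the rows of its Cholesky factor.\<close>

lemma exists_spanning_with_gram:
  fixes a b c f g h :: real
  assumes a: "a > 0" and D: "a * b - h\<^sup>2 > 0"
    and det: "a * b * c + 2 * f * g * h - a * f\<^sup>2 - b * g\<^sup>2 - c * h\<^sup>2 > 0"
  obtains u v w :: "real ^ 3"
  where "spans_parallelepiped u v w"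
    "u \<bullet> u = a" "v \<bullet> v = b" "w \<bullet> w = c" "v \<bullet> w = f" "u \<bullet> w = g" "u \<bullet> v = h"
proof
  define D where "D = a * b - h\<^sup>2"
  define E where "E = a * b * c + 2 * f * g * h - a * f\<^sup>2 - b * g\<^sup>2 - c * h\<^sup>2"
  define r where "r = sqrt a"
  define s where "s = sqrt D"
  have pos: "D > 0" "E > 0" "r > 0" "s > 0"
    using assms by (simp_all add: D_def E_def r_def s_def)
  have sq: "r * r = a" "s * s = D" "sqrt E * sqrt E = E"
    using pos a by (simp_all add: r_def s_def)
  \<comment> \<open>The diagonal entries are the square roots of \<open>a\<close>,
    \<open>D / a\<close> and \<open>E / D\<close>, the ratios of successive minors; the entries
    below the diagonal are then forced by \<open>h\<close>, \<open>g\<close> and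
    \<open>f\<close>.\<close>
  let ?u = "vector [r, 0, 0] :: real ^ 3"
  let ?v = "vector [h / r, s / r, 0] :: real ^ 3"
  let ?w = "vector [g / r, (a * f - g * h) / (r * s), sqrt E / s] :: real ^ 3"
  show "spans_parallelepiped ?u ?v ?w"
    using pos by (intro spans_parallelepiped_triangular) auto
  show "?u \<bullet> ?u = a" "?u \<bullet> ?w = g" "?u \<bullet> ?v = h"
    using pos sq by (simp_all add: inner_vec_def sum_3)
  show "?v \<bullet> ?v = b"
    using pos a sq by (simp add: inner_vec_def sum_3 D_def field_simps power2_eq_square)
  have "?v \<bullet> ?w = h * g / (r * r) + (a * f - g * h) / (r * r)"
    using pos by (simp add: inner_vec_def sum_3)
  also have "\<dots> = f"
    using a by (simp add: sq field_simps)
  finally show "?v \<bullet> ?w = f" .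
  have "?w \<bullet> ?w = g * g / (r * r) + (a * f - g * h)\<^sup>2 / ((r * r) * (s * s)) + sqrt E * sqrt E / (s * s)"
    by (simp add: inner_vec_def sum_3 power2_eq_square mult_ac)
  also have "\<dots> = (g * g * D + (a * f - g * h)\<^sup>2 + a * E) / (a * D)"
    using a pos by (simp add: sq add_frac_eq) (simp add: field_simps)
  \<comment> \<open>This is Sylvester's determinant identity with pivot \<open>a\<close>, namely
    \<open>a * E = D * (a * c - g^2) - (a * f - g * h)^2\<close>.\<close>
  also have "g * g * D + (a * f - g * h)\<^sup>2 + a * E = c * (a * D)"
    by (simp add: D_def E_def power2_eq_square algebra_simps)
  finally show "?w \<bullet> ?w = c"
    using a pos by simp
qed

lemma norm_eqI:
  fixes x :: "'a :: real_inner"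
  assumes "x \<bullet> x = r\<^sup>2" "0 \<le> r"
  shows "norm x = r"
  using assms by (simp add: norm_eq_sqrt_inner)

theorem theorem1:
  shows "(\<exists>u v w :: real ^ 3.
            spans_parallelepiped u v w \<and>
            edge_lengths u v w = [271, 106, 103] \<and>
            minor_face_diagonal_lengths u v w = [101, 266, 255] \<and>
            major_face_diagonal_lengths u v w = [183, 312, 323] \<and>
            body_diagonal_lengths u v w = [374, 300, 278, 272]) \<and>
         (\<exists>u v w :: real ^ 3. perfect_parallelepiped u v w)"
proof -
  \<comment> \<open>The mixed products are \<open>(183^2 - 101^2) / 4\<close>,
    \<open>(312^2 - 266^2) / 4\<close> and \<open>(323^2 - 255^2) / 4\<close>.\<close>
  obtain u v w :: "real ^ 3" where span: "spans_parallelepiped u v w"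
    and gram: "u \<bullet> u = 271\<^sup>2" "v \<bullet> v = 106\<^sup>2" "w \<bullet> w = 103\<^sup>2"
      "v \<bullet> w = 5822" "u \<bullet> w = 6647" "u \<bullet> v = 9826"
    by (rule exists_spanning_with_gram[of "271\<^sup>2" "106\<^sup>2" 9826 "103\<^sup>2" 5822 6647]) auto
  \<comment> \<open>Commutativity is instantiated so that every mixed product is turned to the
    orientation found in \<open>gram\<close>; each squared diagonal then becomes a numeral.\<close>
  note expand = inner_add_left inner_add_right inner_diff_left inner_diff_right
    inner_commute[of v u] inner_commute[of w u] inner_commute[of w v] gram
  have edges: "norm u = 271" "norm v = 106" "norm w = 103"
    by (rule norm_eqI; simp add: gram)+
  have faces: "norm (v - w) = 101" "norm (v + w) = 183" "norm (u - w) = 266"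
    "norm (u + w) = 312" "norm (u - v) = 255" "norm (u + v) = 323"
    by (rule norm_eqI; simp add: expand)+
  have bodies: "norm (u + v + w) = 374" "norm (u + v - w) = 300" "norm (u - v + w) = 278"
    "norm (- u + v + w) = 272"
    by (rule norm_eqI; simp add: expand)+
  have lengths: "edge_lengths u v w = [271, 106, 103]"
    "minor_face_diagonal_lengths u v w = [101, 266, 255]"
    "major_face_diagonal_lengths u v w = [183, 312, 323]"
    "body_diagonal_lengths u v w = [374, 300, 278, 272]"
    by (simp_all only: edge_lengths_def minor_face_diagonal_lengths_def
        major_face_diagonal_lengths_def body_diagonal_lengths_def
        minor_diagonal_def major_diagonal_def edges faces bodies) simp_all
  \<comment> \<open>All lengths are now numerals, so one witness scheme covers positivity and
    integrality of each.\<close>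
  have numeral_length: "\<exists>n::nat. 0 < n \<and> (numeral k :: real) = real n" for k
    by (rule exI[of _ "numeral k"]) simp
  have "perfect_parallelepiped u v w"
    unfolding perfect_parallelepiped_def lengths
    using span by (simp add: numeral_length)
  with span lengths show ?thesis
    by blast
qed

end
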